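(* Let $f:\mathbb{R}^d\to\mathbb{R}\cup\{\infty\}$ be $\ell$-smooth and convex, attaining its minimum at a (not necessarily unique) point $x_*\in\mathbb{R}^d$. Suppose additionally that the function $\psi_2(x)=\frac{x^2}{\ell(2x)}$ on $[0,\infty)$ is strictly increasing and $\psi_2(x)\to\infty$ as $x\to\infty$. Let $x_0\in\mathcal{X}$ and let $\{x_k\}_{k\ge0}$ be generated by $$x_{k+1}=x_k-\gamma_k\nabla f(x_k),\qquad \gamma_k=\int_0^1\frac{dv}{\ell(\|\nabla f(x_k)\|+\|\nabla f(x_k)\|v)}.$$ Then for every integer $T\ge0$, $$\min_{k\in\{0,\dots,T\}}\frac{f(x_k)-f(x_* )}{\ell\left(\frac{2\sqrt{T+1}\,(f(x_k)-f(x_* ))}{\|x_0-x_*\|}\right)}\le\frac{\|x_0-x_*\|^2}{T+1}.$$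
   Context: Norms are Euclidean for vectors and spectral for matrices. For $f:\mathbb{R}^d\to\mathbb{R}\cup\{\infty\}$ put $\mathcal{X}=\{x\in\mathbb{R}^d: f(x)<\infty\}$, assumed to be open and convex. $f$ is $\ell$-smooth if $f$ is twice differentiable on $\mathcal{X}$, $f$ is continuous on the closure of $\mathcal{X}$ (as a map into $\mathbb{R}\cup\{\infty\}$), and $\ell:[0,\infty)\to(0,\infty)$ is a non-decreasing positive locally Lipschitz function such that $\|\nabla^2f(x)\|\le\ell(\|\nabla f(x)\|)$ for all $x\in\mathcal{X}$. (The iteration is well defined: the iterates stay in $\mathcal{X}$.) *)

theory Defs
  imports "HOL-Analysis.Analysis"
begin

definition effective_domain :: "('a \<Rightarrow> ereal) \<Rightarrow> 'a set" where
  "effective_domain f = {x. f x < \<infinity>}"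

text \<open>Functions into \<open>\<real> \<union> {\<infinity>}\<close> are \<open>ereal\<close>-valued functions that never take the value \<open>-\<infinity>\<close>;
  for these, \<open>real_of_ereal\<close> loses no information on the effective domain. The gradient and the Hessian
  below are meaningful only at points of an open effective domain where the derivatives exist.\<close>

definition gradient :: "(real ^ 'n \<Rightarrow> ereal) \<Rightarrow> real ^ 'n \<Rightarrow> real ^ 'n" where
  "gradient f x = (THE g. GDERIV (\<lambda>y. real_of_ereal (f y)) x :> g)"

definition hessian :: "(real ^ 'n \<Rightarrow> ereal) \<Rightarrow> real ^ 'n \<Rightarrow> real ^ 'n ^ 'n" where
  "hessian f x = jacobian (gradient f) (at x)"

text \<open>The operator norm induced by the Euclidean norm.
  (The library's \<open>norm\<close> on matrices is the Frobenius norm.)\<close>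

definition spectral_norm :: "real ^ 'n ^ 'm \<Rightarrow> real" where
  "spectral_norm A = onorm ((*v) A)"

definition twice_differentiable_on :: "(real ^ 'n) set \<Rightarrow> (real ^ 'n \<Rightarrow> ereal) \<Rightarrow> bool" where
  "twice_differentiable_on X f \<longleftrightarrow>
     (\<forall>x\<in>X. (\<lambda>y. real_of_ereal (f y)) differentiable (at x)) \<and>
     (\<forall>x\<in>X. gradient f differentiable (at x))"

text \<open>The library's \<open>local_lipschitz\<close> is for families of functions with a parameter;
  the parameter is a dummy here. Only the values of \<open>l\<close> on \<open>[0, \<infinity>)\<close> matter.\<close>

definition ell_smooth :: "(real \<Rightarrow> real) \<Rightarrow> (real ^ 'n \<Rightarrow> ereal) \<Rightarrow> bool" where
  "ell_smooth l f \<longleftrightarrow>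
     twice_differentiable_on (effective_domain f) f \<and>
     continuous_on (closure (effective_domain f)) f \<and>
     (\<forall>s\<ge>0. l s > 0) \<and>
     mono_on {0..} l \<and>
     local_lipschitz (UNIV :: real set) {0..} (\<lambda>_. l) \<and>
     (\<forall>x\<in>effective_domain f. spectral_norm (hessian f x) \<le> l (norm (gradient f x)))"

text \<open>In \<open>ereal\<close> we have \<open>0 * \<infinity> = 0\<close>, so the cases \<open>u = 0\<close> and \<open>v = 0\<close> hold trivially.\<close>

definition convex_extended :: "(real ^ 'n \<Rightarrow> ereal) \<Rightarrow> bool" where
  "convex_extended f \<longleftrightarrow>
     (\<forall>x y. \<forall>u\<ge>0. \<forall>v\<ge>0. u + v = 1 \<longrightarrow>
        f (u *\<^sub>R x + v *\<^sub>R y) \<le> ereal u * f x + ereal v * f y)"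

end

theory Submission
  imports Defs
begin

text \<open>The squared distance to the minimizer drops by at least \<open>2 \<gamma>\<^sub>k \<Delta>\<^sub>k\<close> in every step, where
  \<open>\<Delta>\<^sub>k = f (x k) - f xs\<close> and \<open>\<gamma>\<^sub>k\<close> is the step size. Summing up, some \<open>k \<le> T\<close> satisfies
  \<open>\<gamma>\<^sub>k \<Delta>\<^sub>k \<le> R\<^sup>2 / (2 (T + 1))\<close> with \<open>R = \<parallel>x 0 - xs\<parallel>\<close>. What remains is to trade the step
  size, which is governed by the gradient norm \<open>g\<close> at \<open>x k\<close>, for \<open>\<Delta>\<^sub>k\<close>. Put
  \<open>s = sqrt (T + 1) \<Delta>\<^sub>k / R\<close>; the claim for this \<open>k\<close> reads \<open>s\<^sup>2 \<le> \<Delta>\<^sub>k l (2 s)\<close>.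

  If \<open>g \<ge> sqrt 2 s\<close>, the claim follows from the lower bound \<open>\<Delta>\<^sub>k \<ge> p\<^sup>2 / (2 l p)\<close>, valid
  for all \<open>0 < p \<le> g\<close> (lemma \<open>gap_lower_bound\<close>), at \<open>p = sqrt 2 s \<le> 2 s\<close>. The freedom to choose
  \<open>p\<close> below the actual gradient norm is what makes this work. If \<open>g < sqrt 2 s\<close>, then strict
  monotonicity of \<open>s\<^sup>2 / l (2 s)\<close> limits the growth of \<open>l\<close> to \<open>l (2 g) \<le> 2 l (2 s)\<close>, so
  \<open>\<gamma>\<^sub>k \<ge> 1 / l (2 g) \<ge> 1 / (2 l (2 s))\<close>, and the averaged bound on \<open>\<gamma>\<^sub>k \<Delta>\<^sub>k\<close> gives the claim
  (lemma \<open>step_size_to_gap\<close>).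

  The decrease of the distance is the inequality
  \<open>\<langle>\<nabla>f x, x - xs\<rangle> \<ge> f x - f xs + \<parallel>\<nabla>f x\<parallel>\<^sup>2 / (2 l \<parallel>\<nabla>f x\<parallel>)\<close> (lemma \<open>inner_lower_bound\<close>). As in the
  classical smooth case it is obtained by evaluating \<open>f\<close> at one suitable point, here
  \<open>xs + \<nabla>f x / l \<parallel>\<nabla>f x\<parallel>\<close>. It must be known that such a point lies in the domain and that the Hessian is under control on the way
  there. This is the content of the lemmas \<open>step_in_domain\<close> and \<open>step_upper_bound\<close>: to change the
  gradient by \<open>r\<close> from a point of gradient norm \<open>a\<close>, a path must have length at least
  \<open>\<integral>\<^sub>0\<^sup>r du / l (a + u)\<close>, and \<open>f\<close> cannot blow up while its gradient is bounded. The step from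
  \<open>x k\<close> to \<open>x (k + 1)\<close> has exactly this length for \<open>a = r = g\<close>, so all iterates stay in the domain.

  The lower bound \<open>p\<^sup>2 / (2 l p)\<close> on the gap comes from the same two lemmas, applied to many short
  steps against the gradient. Each lets the gradient norm drop by at most \<open>p / n\<close>, and moving towards
  \<open>xs\<close> between the steps keeps it below \<open>p + p / n\<close> throughout; the decreases of \<open>f\<close> add up to
  \<open>p\<^sup>2 / (2 l (p + p / n))\<close>. For a single step the lemmas only control the gradient norm by \<open>2 p\<close>, which
  would put \<open>l (2 p)\<close> into the denominator.\<close>

section \<open>Smoothness with respect to the gradient norm\<close>

text \<open>The domain is open while the sublevel sets are closed in the whole space: this is the form in
  which continuity of \<open>f\<close> on the closure of its domain enters, since it makes \<open>F\<close> blow up at the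
  boundary.\<close>

locale generalized_smooth =
  fixes X :: "'a::euclidean_space set"
    and F :: "'a \<Rightarrow> real"
    and G :: "'a \<Rightarrow> 'a"
    and H :: "'a \<Rightarrow> 'a \<Rightarrow> 'a"
    and l :: "real \<Rightarrow> real"
  assumes open_dom: "open X"
    and convex_dom: "convex X"
    and closed_sublevel: "\<And>B. closed {y \<in> X. F y \<le> B}"
    and F_deriv: "\<And>y. y \<in> X \<Longrightarrow> (F has_derivative (\<lambda>h. G y \<bullet> h)) (at y)"
    and G_deriv: "\<And>y. y \<in> X \<Longrightarrow> (G has_derivative H y) (at y)"
    and H_bound: "\<And>y h. y \<in> X \<Longrightarrow> norm (H y h) \<le> l (norm (G y)) * norm h"
    and l_pos: "\<And>s. 0 \<le> s \<Longrightarrow> 0 < l s"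
    and l_mono: "\<And>s t. 0 \<le> s \<Longrightarrow> s \<le> t \<Longrightarrow> l s \<le> l t"
    and l_cont: "continuous_on {0..} l"
begin

text \<open>A lower bound on the length of a path that changes the gradient by \<open>r\<close>, starting at gradient
  norm \<open>a\<close>: while the gradient has changed by \<open>u\<close>, its rate of change is at most \<open>l (a + u)\<close>.\<close>

definition min_length :: "real \<Rightarrow> real \<Rightarrow> real" where
  "min_length a r = integral {0..r} (\<lambda>u. 1 / l (a + u))"

lemma min_length_0 [simp]: "min_length a 0 = 0"
  by (simp add: min_length_def)

lemma continuous_inverse_l:
  assumes "0 \<le> a"
  shows "continuous_on {0..r} (\<lambda>u. 1 / l (a + u))"
proof (intro continuous_on_divide continuous_on_const continuous_on_compose2[OF l_cont]
    continuous_on_add continuous_on_id ballI)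
  show "(\<lambda>u. a + u) ` {0..r} \<subseteq> {0..}" using assms by auto
  show "l (a + u) \<noteq> 0" if "u \<in> {0..r}" for u
    using l_pos[of "a + u"] assms that by auto
qed

lemma DERIV_min_length:
  assumes "0 \<le> a" "0 < r"
  shows "(min_length a has_real_derivative 1 / l (a + r)) (at r)"
proof -
  have "r \<in> {0..r+1}" using assms by simp
  from integral_has_real_derivative[OF continuous_inverse_l[OF assms(1)] this]
  have "(min_length a has_real_derivative 1 / l (a + r)) (at r within {0..r+1})"
    unfolding min_length_def[abs_def] .
  moreover have "at r within {0..r+1} = at r"
    using assms by (intro at_within_interior) simp
  ultimately show ?thesis by (simp only:)
qed

lemma min_length_diff_bounds:
  assumes "0 \<le> a" "0 \<le> r" "r \<le> r'"
  shows "(r' - r) / l (a + r') \<le> min_length a r' - min_length a r"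
    and "min_length a r' - min_length a r \<le> (r' - r) / l (a + r)"
proof -
  have int: "(\<lambda>u. 1 / l (a + u)) integrable_on {0..r'}"
    using continuous_inverse_l[OF assms(1)] by (rule integrable_continuous_interval)
  have int': "(\<lambda>u. 1 / l (a + u)) integrable_on {r..r'}"
    by (rule integrable_subinterval_real[OF int]) (use assms in auto)
  have diff: "min_length a r' - min_length a r = integral {r..r'} (\<lambda>u. 1 / l (a + u))"
    using Henstock_Kurzweil_Integration.integral_combine[OF assms(2,3) int]
    by (simp add: min_length_def)
  have "integral {r..r'} (\<lambda>u. 1 / l (a + r')) \<le> integral {r..r'} (\<lambda>u. 1 / l (a + u))"
    using assms by (intro integral_le int' integrable_const_ivl)
      (auto intro!: divide_left_mono l_mono mult_pos_pos l_pos)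
  then show "(r' - r) / l (a + r') \<le> min_length a r' - min_length a r"
    using assms by (simp add: diff)
  have "integral {r..r'} (\<lambda>u. 1 / l (a + u)) \<le> integral {r..r'} (\<lambda>u. 1 / l (a + r))"
    using assms by (intro integral_le int' integrable_const_ivl)
      (auto intro!: divide_left_mono l_mono mult_pos_pos l_pos)
  then show "min_length a r' - min_length a r \<le> (r' - r) / l (a + r)"
    using assms by (simp add: diff)
qed

lemma min_length_le_imp_le:
  assumes "0 \<le> a" "0 \<le> r" "min_length a q \<le> min_length a r"
  shows "q \<le> r"
proof (rule ccontr)
  assume "\<not> q \<le> r"
  then have "0 < (q - r) / l (a + q)"
    using assms l_pos[of "a + q"] by simp
  then show False
    using min_length_diff_bounds(1)[of a r q] assms \<open>\<not> q \<le> r\<close> by linarith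
qed

lemma F_along_line_deriv:
  assumes "y + t *\<^sub>R h \<in> X"
  shows "((\<lambda>t. F (y + t *\<^sub>R h)) has_real_derivative G (y + t *\<^sub>R h) \<bullet> h) (at t)"
proof -
  have "((\<lambda>t. y + t *\<^sub>R h) has_derivative (\<lambda>u. u *\<^sub>R h)) (at t)"
    by (auto intro!: derivative_eq_intros)
  from has_derivative_compose[OF this F_deriv[OF assms]] show ?thesis
    by (simp add: has_field_derivative_def mult.commute[of _ "G (y + t *\<^sub>R h) \<bullet> h"])
qed

lemma G_along_line_deriv:
  assumes "y + t *\<^sub>R h \<in> X"
  shows "((\<lambda>t. G (y + t *\<^sub>R h)) has_derivative (\<lambda>u. u *\<^sub>R H (y + t *\<^sub>R h) h)) (at t)"
proof -
  have *: "((\<lambda>t. y + t *\<^sub>R h) has_derivative (\<lambda>u. u *\<^sub>R h)) (at t)"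
    by (auto intro!: derivative_eq_intros)
  have "H (y + t *\<^sub>R h) (u *\<^sub>R h) = u *\<^sub>R H (y + t *\<^sub>R h) h" for u
    using has_derivative_linear[OF G_deriv[OF assms]] by (rule linear_cmul)
  with has_derivative_compose[OF * G_deriv[OF assms]] show ?thesis
    by simp
qed

text \<open>The change \<open>q\<close> of the gradient obeys \<open>q' \<le> l (a + q) \<parallel>h\<parallel>\<close>, and separating the variables
  gives the claim. Since \<open>q\<close> is not differentiable where it vanishes, it is replaced by
  \<open>sqrt (q\<^sup>2 + e\<^sup>2)\<close>, which obeys the same differential inequality.\<close>

lemma min_length_gradient_change:
  assumes path: "\<And>t. 0 \<le> t \<Longrightarrow> t \<le> \<tau> \<Longrightarrow> y + t *\<^sub>R h \<in> X" and "0 \<le> \<tau>"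
  shows "min_length (norm (G y)) (norm (G (y + \<tau> *\<^sub>R h) - G y)) \<le> \<tau> * norm h"
proof -
  define a where "a = norm (G y)"
  define D where "D t = G (y + t *\<^sub>R h) - G y" for t
  have a: "0 \<le> a" by (simp add: a_def)
  have approx: "min_length a (norm (D \<tau>)) \<le> \<tau> * norm h + e / l a" if e: "0 < e" for e
  proof -
    define q where "q t = sqrt (D t \<bullet> D t + e\<^sup>2)" for t
    have q_ge: "norm (D t) \<le> q t" for t
      unfolding q_def by (rule real_le_rsqrt) (simp add: power2_norm_eq_inner)
    have q_pos: "0 < q t" for t
      using e by (simp add: q_def add_nonneg_pos)
    have step: "\<exists>z. ((\<lambda>t. min_length a (q t) - t * norm h) has_real_derivative z) (at t) \<and> z \<le> 0"
      if t: "0 \<le> t" "t \<le> \<tau>" for t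
    proof -
      define v where "v = H (y + t *\<^sub>R h) h"
      have "(D has_derivative (\<lambda>u. u *\<^sub>R v)) (at t)"
        unfolding D_def v_def using has_derivative_diff[OF G_along_line_deriv[OF path[OF t]]
          has_derivative_const[of "G y"]] by simp
      then have "((\<lambda>t. D t \<bullet> D t + e\<^sup>2) has_derivative
          (\<lambda>u. D t \<bullet> (u *\<^sub>R v) + (u *\<^sub>R v) \<bullet> D t)) (at t)"
        by (auto intro!: derivative_eq_intros)
      then have "((\<lambda>t. D t \<bullet> D t + e\<^sup>2) has_real_derivative 2 * (D t \<bullet> v)) (at t)"
        by (rule has_derivative_imp_has_field_derivative)
          (simp add: inner_commute)
      then have "(q has_real_derivative
          (inverse (sqrt (D t \<bullet> D t + e\<^sup>2)) / 2) * (2 * (D t \<bullet> v))) (at t)"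
        unfolding q_def
        by (rule DERIV_chain2[OF DERIV_real_sqrt, rotated]) (use e in \<open>simp add: add_nonneg_pos\<close>)
      then have q_deriv: "(q has_real_derivative (D t \<bullet> v) / q t) (at t)"
        by (simp add: q_def field_simps)
      then have deriv: "((\<lambda>t. min_length a (q t) - t * norm h) has_real_derivative
          1 / l (a + q t) * ((D t \<bullet> v) / q t) - norm h) (at t)"
        using DERIV_diff[OF DERIV_chain2[where f = "min_length a" and g = q, OF
            DERIV_min_length[OF a q_pos] q_deriv] DERIV_cmult_right[OF DERIV_ident, of "norm h"]]
        by simp
      have l_q: "0 < l (a + q t)"
        using a q_pos[of t] by (intro l_pos) simp
      have "norm (G (y + t *\<^sub>R h)) \<le> a + q t"
        using norm_triangle_ineq[of "G y" "D t"] q_ge[of t] by (simp add: D_def a_def)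
      then have "norm v \<le> l (a + q t) * norm h"
        unfolding v_def using H_bound[OF path[OF t], of h]
        by (meson l_mono mult_right_mono norm_ge_zero order_trans)
      moreover have "(D t \<bullet> v) / q t \<le> norm v"
      proof -
        have "D t \<bullet> v \<le> norm (D t) * norm v" by (rule norm_cauchy_schwarz)
        also have "\<dots> \<le> q t * norm v" by (intro mult_right_mono q_ge) simp
        finally show ?thesis using q_pos[of t] by (simp add: field_simps)
      qed
      ultimately have "1 / l (a + q t) * ((D t \<bullet> v) / q t) \<le> norm h"
      proof -
        have "(D t \<bullet> v) / q t \<le> norm h * l (a + q t)"
          using \<open>norm v \<le> l (a + q t) * norm h\<close> \<open>(D t \<bullet> v) / q t \<le> norm v\<close>
          by (simp add: mult.commute)
        then have "(D t \<bullet> v) / q t / l (a + q t) \<le> norm h"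
          using l_q by (simp only: pos_divide_le_eq)
        then show ?thesis by (simp add: mult.commute)
      qed
      with deriv show ?thesis by force
    qed
    have "min_length a (q \<tau>) - \<tau> * norm h \<le> min_length a (q 0) - 0 * norm h"
      using \<open>0 \<le> \<tau>\<close> step by (rule DERIV_nonpos_imp_nonincreasing)
    moreover have "q 0 = e" using e by (simp add: q_def D_def)
    moreover have "min_length a e \<le> e / l a"
      using min_length_diff_bounds(2)[of a 0 e] a e by simp
    moreover have "min_length a (norm (D \<tau>)) \<le> min_length a (q \<tau>)"
    proof -
      have "0 \<le> (q \<tau> - norm (D \<tau>)) / l (a + q \<tau>)"
        using q_ge[of \<tau>] q_pos[of \<tau>] a l_pos[of "a + q \<tau>"] by simp
      then show ?thesis
        using min_length_diff_bounds(1)[OF a norm_ge_zero q_ge[of \<tau>]] by linarith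
    qed
    ultimately show ?thesis by simp
  qed
  have "min_length a (norm (D \<tau>)) \<le> \<tau> * norm h"
  proof (rule field_le_epsilon)
    fix e :: real assume "0 < e"
    then show "min_length a (norm (D \<tau>)) \<le> \<tau> * norm h + e"
      using approx[of "e * l a"] l_pos[OF a] by simp
  qed
  then show ?thesis by (simp add: a_def D_def)
qed

text \<open>As long as the segment stays in the domain, the gradient norm is at most \<open>a + d\<close> and so \<open>F\<close> is
  bounded. A first exit point would thus be the limit of domain points from one sublevel set,
  contradicting closedness of the sublevel sets.\<close>

lemma step_in_domain:
  assumes y: "y \<in> X" and d: "0 \<le> d" and h: "norm h \<le> min_length (norm (G y)) d"
    and t: "0 \<le> t" "t \<le> 1"
  shows "y + t *\<^sub>R h \<in> X" and "norm (G (y + t *\<^sub>R h) - G y) \<le> d"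
proof -
  have change: "norm (G (y + t *\<^sub>R h) - G y) \<le> d"
    if "0 \<le> t" "t \<le> 1" "y + t *\<^sub>R h \<in> X" for t
  proof -
    have segment: "y + u *\<^sub>R h \<in> X" if u: "0 \<le> u" "u \<le> t" for u
    proof (cases "t = 0")
      case False
      have "(1 - u / t) *\<^sub>R y + (u / t) *\<^sub>R (y + t *\<^sub>R h) \<in> X"
        by (rule convexD_alt[OF convex_dom y \<open>y + t *\<^sub>R h \<in> X\<close>]) (use u False in simp_all)
      moreover have "(1 - u / t) *\<^sub>R y + (u / t) *\<^sub>R (y + t *\<^sub>R h) = y + u *\<^sub>R h"
        using False by (simp add: scaleR_add_right scaleR_diff_left)
      ultimately show ?thesis by (simp only:)
    qed (use u y in auto)
    have "min_length (norm (G y)) (norm (G (y + t *\<^sub>R h) - G y)) \<le> t * norm h"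
      by (rule min_length_gradient_change[OF segment \<open>0 \<le> t\<close>])
    also have "\<dots> \<le> min_length (norm (G y)) d"
      using h \<open>t \<le> 1\<close> mult_right_mono[of t 1 "norm h"] by simp
    finally show ?thesis by (rule min_length_le_imp_le[OF norm_ge_zero d])
  qed
  define A where "A = {t \<in> {0..1}. y + t *\<^sub>R h \<notin> X}"
  have "A = {0..1} \<inter> (\<lambda>t. y + t *\<^sub>R h) -` (- X)"
    by (auto simp: A_def)
  moreover have "closed ({0..1} \<inter> (\<lambda>t. y + t *\<^sub>R h) -` (- X))"
    using open_dom by (intro continuous_closed_preimage continuous_intros) auto
  ultimately have "closed A" by simp
  have "A = {}"
  proof (rule ccontr)
    assume "A \<noteq> {}"
    moreover have bdd: "bdd_below A" by (auto simp: A_def intro: bdd_belowI[of _ 0])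
    ultimately have "Inf A \<in> A" using \<open>closed A\<close> by (intro closed_contains_Inf)
    define b where "b = Inf A"
    have b: "0 \<le> b" "b \<le> 1" "y + b *\<^sub>R h \<notin> X"
      using \<open>Inf A \<in> A\<close> by (auto simp: A_def b_def)
    then have "0 < b" using y by (cases "b = 0") auto
    have inX: "y + t *\<^sub>R h \<in> X" if "0 \<le> t" "t < b" for t
      using cInf_lower[OF _ bdd, of t] that b by (auto simp: A_def b_def)
    define M where "M = (norm (G y) + d) * norm h"
    have "F (y + t *\<^sub>R h) \<le> F y + M" if t: "0 \<le> t" "t < b" for t
    proof -
      have "F (y + t *\<^sub>R h) - t * M \<le> F (y + 0 *\<^sub>R h) - 0 * M"
      proof (rule DERIV_nonpos_imp_nonincreasing[OF t(1)])
        fix u assume u: "0 \<le> u" "u \<le> t"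
        have "((\<lambda>t. F (y + t *\<^sub>R h) - t * M) has_real_derivative G (y + u *\<^sub>R h) \<bullet> h - M) (at u)"
          using DERIV_diff[OF F_along_line_deriv[OF inX[of u]]
              DERIV_cmult_right[OF DERIV_ident, of M]] u t by simp
        moreover have "G (y + u *\<^sub>R h) \<bullet> h \<le> M"
        proof -
          have "norm (G (y + u *\<^sub>R h)) \<le> norm (G y) + d"
            using change[of u] inX[of u] u t b norm_triangle_sub[of "G (y + u *\<^sub>R h)" "G y"] by force
          then have "norm (G (y + u *\<^sub>R h)) * norm h \<le> M"
            unfolding M_def by (rule mult_right_mono) simp
          then show ?thesis using norm_cauchy_schwarz[of "G (y + u *\<^sub>R h)" h] by linarith
        qed
        ultimately show "\<exists>z. ((\<lambda>t. F (y + t *\<^sub>R h) - t * M) has_real_derivative z) (at u) \<and> z \<le> 0"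
          by force
      qed
      moreover have "t * M \<le> M"
        using t b d mult_right_mono[of t 1 M] by (simp add: M_def)
      ultimately show ?thesis by simp
    qed
    then have "(\<lambda>t. y + t *\<^sub>R h) ` {0..<b} \<subseteq> {z \<in> X. F z \<le> F y + M}"
      using inX by auto
    then have "(\<lambda>t. y + t *\<^sub>R h) ` closure {0..<b} \<subseteq> {z \<in> X. F z \<le> F y + M}"
      by (intro image_closure_subset closed_sublevel continuous_intros)
    moreover have "b \<in> closure {0..<b}" using \<open>0 < b\<close> by simp
    ultimately have "y + b *\<^sub>R h \<in> {z \<in> X. F z \<le> F y + M}" by blast
    then show False using b by simp
  qed
  then show "y + t *\<^sub>R h \<in> X" using t by (auto simp: A_def)
  then show "norm (G (y + t *\<^sub>R h) - G y) \<le> d" using t by (intro change)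
qed

text \<open>The quadratic upper bound of the classical smooth case, with the Hessian bound taken at the
  largest gradient norm that the step can meet.\<close>

lemma step_upper_bound:
  assumes y: "y \<in> X" and d: "0 \<le> d" and h: "norm h \<le> min_length (norm (G y)) d"
  shows "F (y + h) \<le> F y + G y \<bullet> h + l (norm (G y) + d) * (norm h)\<^sup>2 / 2"
proof -
  define L where "L = l (norm (G y) + d)"
  have L: "0 < L" using d by (auto simp: L_def intro!: l_pos)
  note inX = step_in_domain(1)[OF y d h] and change = step_in_domain(2)[OF y d h]
  define \<phi> where "\<phi> t = F (y + t *\<^sub>R h) - t * (G y \<bullet> h) - L * (norm h)\<^sup>2 / 2 * t\<^sup>2" for t
  have "\<phi> 1 \<le> \<phi> 0"
  proof (rule DERIV_nonpos_imp_nonincreasing[of 0 1 \<phi>])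
    fix t :: real assume t: "0 \<le> t" "t \<le> 1"
    define q where "q = norm (G (y + t *\<^sub>R h) - G y)"
    have "(\<phi> has_real_derivative G (y + t *\<^sub>R h) \<bullet> h - G y \<bullet> h - L * (norm h)\<^sup>2 * t) (at t)"
      unfolding \<phi>_def
      using DERIV_diff[OF DERIV_diff[OF F_along_line_deriv[OF inX[OF t]]
            DERIV_cmult_right[OF DERIV_ident, of "G y \<bullet> h"]]
          DERIV_cmult[OF DERIV_pow[of 2], of "L * (norm h)\<^sup>2 / 2"]]
      by (simp add: mult.assoc)
    moreover have "G (y + t *\<^sub>R h) \<bullet> h - G y \<bullet> h \<le> L * (norm h)\<^sup>2 * t"
    proof -
      have "q / L \<le> q / l (norm (G y) + q)"
        using change[OF t] L d unfolding L_def q_def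
        by (intro divide_left_mono l_mono mult_pos_pos l_pos) auto
      also have "\<dots> \<le> min_length (norm (G y)) q"
        using min_length_diff_bounds(1)[of "norm (G y)" 0 q] by (simp add: q_def)
      also have "\<dots> \<le> t * norm h"
        unfolding q_def using t inX by (intro min_length_gradient_change) auto
      finally have "q \<le> L * (t * norm h)"
        using L by (simp add: field_simps)
      then have "q * norm h \<le> L * (t * norm h) * norm h"
        by (rule mult_right_mono) simp
      then show ?thesis
        using norm_cauchy_schwarz[of "G (y + t *\<^sub>R h) - G y" h]
        by (simp add: q_def inner_diff_left power2_eq_square mult_ac)
    qed
    ultimately show "\<exists>z. (\<phi> has_real_derivative z) (at t) \<and> z \<le> 0" by force
  qed simp
  then show ?thesis by (simp add: \<phi>_def L_def)
qed

end

section \<open>Convex functions with a minimizer\<close>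

locale convex_generalized_smooth = generalized_smooth +
  fixes xs :: "'a::euclidean_space"
  assumes convex_F: "convex_on X F"
    and minimizer: "xs \<in> X" "\<And>y. y \<in> X \<Longrightarrow> F xs \<le> F y"
begin

lemma above_tangent:
  assumes "x \<in> X" "y \<in> X"
  shows "F x + G x \<bullet> (y - x) \<le> F y"
proof (rule ccontr)
  assume neg: "\<not> ?thesis"
  define \<phi> where "\<phi> t = F (x + t *\<^sub>R (y - x)) - t * (F y - F x)" for t
  have deriv: "(\<phi> has_real_derivative G x \<bullet> (y - x) - (F y - F x)) (at 0)"
    unfolding \<phi>_def using assms DERIV_diff[OF F_along_line_deriv[of x 0 "y - x"]
      DERIV_cmult_right[OF DERIV_ident, of "F y - F x"]] by simp
  then obtain d where d: "0 < d" "\<And>t. 0 < t \<Longrightarrow> t < d \<Longrightarrow> \<phi> 0 < \<phi> t"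
    using DERIV_pos_inc_right[OF deriv] neg by auto
  define t where "t = min 1 (d / 2)"
  have t: "0 < t" "t < d" "t \<le> 1" using d(1) by (auto simp: t_def)
  have "x + t *\<^sub>R (y - x) = (1 - t) *\<^sub>R x + t *\<^sub>R y"
    by (simp add: algebra_simps)
  then have "F (x + t *\<^sub>R (y - x)) \<le> (1 - t) * F x + t * F y"
    using convex_onD[OF convex_F, of t x y] t assms by simp
  then have "\<phi> t \<le> \<phi> 0"
    by (simp add: \<phi>_def algebra_simps)
  with d(2)[OF t(1,2)] show False by simp
qed

lemma G_minimizer: "G xs = 0"
proof -
  have "(\<lambda>h. G xs \<bullet> h) = (\<lambda>h. 0)"
    using differential_zero_maxmin[OF minimizer(1) open_dom F_deriv[OF minimizer(1)]]
      minimizer(2) by blast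
  from fun_cong[OF this, of "G xs"] show ?thesis by simp
qed

text \<open>The classical proof for Lipschitz gradients: \<open>F\<close> lies above its tangent at \<open>x\<close> and below a
  parabola at \<open>xs\<close>; compare the two at \<open>xs + G x / l \<parallel>G x\<parallel>\<close>. On the way from \<open>xs\<close> to that point the
  gradient norm stays below \<open>\<parallel>G x\<parallel>\<close>, since it starts at \<open>0\<close>.\<close>

lemma inner_lower_bound:
  assumes x: "x \<in> X"
  shows "F x - F xs + (norm (G x))\<^sup>2 / (2 * l (norm (G x))) \<le> G x \<bullet> (x - xs)"
proof -
  define g where "g = norm (G x)"
  define h where "h = (1 / l g) *\<^sub>R G x"
  have g: "0 \<le> g" and L: "0 < l g" by (auto simp: g_def intro: l_pos)
  have norm_h: "norm h = g / l g" using L by (simp add: h_def g_def)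
  have h: "norm h \<le> min_length (norm (G xs)) g"
    using min_length_diff_bounds(1)[of 0 0 g] g by (simp add: norm_h G_minimizer)
  have "xs + h \<in> X"
    using step_in_domain(1)[OF minimizer(1) g h, of 1] by simp
  then have "F x + G x \<bullet> (xs + h - x) \<le> F (xs + h)"
    by (rule above_tangent[OF x])
  also have "\<dots> \<le> F xs + l g * (g / l g)\<^sup>2 / 2"
    using step_upper_bound[OF minimizer(1) g h] by (simp add: G_minimizer norm_h)
  also have "l g * (g / l g)\<^sup>2 / 2 = g\<^sup>2 / (2 * l g)"
    using L by (simp add: power2_eq_square field_simps)
  finally have "F x + G x \<bullet> (xs + h - x) \<le> F xs + g\<^sup>2 / (2 * l g)" .
  moreover have "G x \<bullet> h = 2 * (g\<^sup>2 / (2 * l g))"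
    using L by (simp add: h_def g_def power2_norm_eq_inner)
  ultimately show ?thesis
    by (simp add: g_def inner_diff_right inner_add_right)
qed

text \<open>Induction on \<open>n\<close>: a step of length \<open>d / L\<close> against the gradient lowers the gradient norm by at
  most \<open>d\<close>, and it lowers \<open>F\<close> by enough to account for the difference of the squares
  \<open>((n + 1) d)\<^sup>2\<close> and \<open>(n d)\<^sup>2\<close>. Before the step, \<open>z\<close> is moved towards \<open>xs\<close> until its gradient norm
  equals \<open>(n + 1) d\<close>; by convexity this does not increase \<open>F\<close>.\<close>

lemma gap_lower_bound_grid:
  assumes d: "0 < d"
  shows "z \<in> X \<Longrightarrow> real n * d \<le> norm (G z) \<Longrightarrow> l ((real n + 1) * d) \<le> L \<Longrightarrow>
    (real n * d)\<^sup>2 \<le> 2 * L * (F z - F xs)"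
proof (induction n arbitrary: z)
  case 0
  have "0 < L" using 0(3) l_pos[of d] d by simp
  then show ?case using minimizer(2)[OF 0(1)] by simp
next
  case (Suc n)
  define p where "p = real (Suc n) * d"
  have p: "0 < p" using d by (simp add: p_def)
  have lL: "l (p + d) \<le> L" using Suc.prems(3) by (simp add: p_def algebra_simps)
  have l_pd: "0 < l (p + d)" using p d by (intro l_pos) simp
  with lL have L: "0 < L" by linarith
  define c where "c t = (1 - t) *\<^sub>R xs + t *\<^sub>R z" for t
  have c_in: "c t \<in> X" if "0 \<le> t" "t \<le> 1" for t
    unfolding c_def using convex_dom minimizer(1) Suc.prems(1) that by (rule convexD_alt)
  have "continuous_on {0..1} (\<lambda>t. norm (G (c t)))"
  proof (rule continuous_on_norm, rule continuous_on_compose2[where g = G and f = c])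
    show "continuous_on X G"
      using G_deriv by (meson continuous_at_imp_continuous_on has_derivative_continuous)
    show "continuous_on {0..1} c"
      unfolding c_def by (intro continuous_intros)
  qed (use c_in in auto)
  moreover have "norm (G (c 0)) \<le> p" "p \<le> norm (G (c 1))"
    using p Suc.prems(2) by (auto simp: c_def G_minimizer p_def)
  ultimately obtain t where t: "0 \<le> t" "t \<le> 1" "norm (G (c t)) = p"
    using IVT'[of "\<lambda>t. norm (G (c t))" 0 p 1] by auto
  define h where "h = - (d / (p * L)) *\<^sub>R G (c t)"
  have norm_h: "norm h = d / L"
    using d p L by (simp add: h_def t(3))
  have "d / L \<le> d / l (p + d)"
    using d L l_pd lL by (intro divide_left_mono) auto
  also have "\<dots> \<le> min_length p d"
    using min_length_diff_bounds(1)[of p 0 d] p d by simp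
  finally have h: "norm h \<le> min_length (norm (G (c t))) d"
    by (simp add: norm_h t(3))
  have d0: "0 \<le> d" using d by simp
  note ct = c_in[OF t(1,2)]
  have end_in: "c t + h \<in> X" and change: "norm (G (c t + h) - G (c t)) \<le> d"
    using step_in_domain[OF ct d0 h, of 1] by auto
  have "F (c t + h) \<le> F (c t) + G (c t) \<bullet> h + l (p + d) * (d / L)\<^sup>2 / 2"
    using step_upper_bound[OF ct d0 h] by (simp add: norm_h t(3))
  also have "\<dots> \<le> F (c t) + G (c t) \<bullet> h + L * (d / L)\<^sup>2 / 2"
    using lL by (simp add: mult_right_mono)
  also have "G (c t) \<bullet> h = - (d * p / L)"
  proof -
    have "G (c t) \<bullet> h = - (d / (p * L)) * p\<^sup>2"
      using t(3) by (simp add: h_def flip: power2_norm_eq_inner)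
    then show ?thesis using p by (simp add: power2_eq_square)
  qed
  also have "L * (d / L)\<^sup>2 / 2 = d\<^sup>2 / (2 * L)"
    using L by (simp add: power2_eq_square)
  finally have decrease: "2 * L * F (c t + h) \<le> 2 * L * F (c t) - 2 * d * p + d\<^sup>2"
    using L by (simp add: field_simps)
  have "real n * d \<le> norm (G (c t + h))"
    using change t(3) norm_triangle_ineq2[of "G (c t)" "G (c t + h)"]
    by (simp add: p_def algebra_simps norm_minus_commute)
  moreover have "l ((real n + 1) * d) \<le> L"
  proof -
    have "l ((real n + 1) * d) \<le> l (p + d)"
      using d by (intro l_mono) (simp_all add: p_def algebra_simps)
    with lL show ?thesis by linarith
  qed
  ultimately have "(real n * d)\<^sup>2 \<le> 2 * L * (F (c t + h) - F xs)"
    using Suc.IH[OF end_in] by blast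
  then have "p\<^sup>2 \<le> 2 * L * (F (c t) - F xs)"
    using decrease by (simp add: p_def power2_eq_square algebra_simps)
  also have "\<dots> \<le> 2 * L * (F z - F xs)"
  proof -
    have "F (c t) \<le> (1 - t) * F xs + t * F z"
      unfolding c_def using convex_onD[OF convex_F t(1,2) minimizer(1) Suc.prems(1)] .
    also have "\<dots> \<le> (1 - t) * F z + t * F z"
      using t minimizer(2)[OF Suc.prems(1)] by (intro add_right_mono mult_left_mono) auto
    finally show ?thesis using L by (simp add: algebra_simps)
  qed
  finally show ?case by (simp add: p_def)
qed

lemma gap_lower_bound:
  assumes z: "z \<in> X" and p: "0 < p" "p \<le> norm (G z)"
  shows "p\<^sup>2 / (2 * l p) \<le> F z - F xs"
proof -
  \<comment> \<open>\<open>m\<close> steps, each changing the gradient by at most \<open>p / m\<close>, give the bound with \<open>l (p + p / m)\<close>.\<close>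
  have approx: "p\<^sup>2 \<le> 2 * l (p + p / real (Suc m)) * (F z - F xs)" for m
  proof -
    have "(real (Suc m) + 1) * (p / real (Suc m)) = p + p / real (Suc m)"
      "real (Suc m) * (p / real (Suc m)) = p"
      by (simp_all add: field_simps)
    with gap_lower_bound_grid[of "p / real (Suc m)" z "Suc m" "l (p + p / real (Suc m))"] z p
    show ?thesis by simp
  qed
  have "(\<lambda>m. p + p / real (Suc m)) \<longlonglongrightarrow> p + 0"
    by (intro tendsto_add tendsto_const LIMSEQ_Suc lim_const_over_n)
  then have "(\<lambda>m. l (p + p / real (Suc m))) \<longlonglongrightarrow> l p"
    using p by (intro continuous_on_tendsto_compose[OF l_cont]) (auto intro!: always_eventually)
  then have "(\<lambda>m. 2 * l (p + p / real (Suc m)) * (F z - F xs)) \<longlonglongrightarrow> 2 * l p * (F z - F xs)"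
    by (intro tendsto_intros)
  then have "p\<^sup>2 \<le> 2 * l p * (F z - F xs)"
    by (rule LIMSEQ_le_const) (use approx in blast)
  then show ?thesis
    using l_pos[of p] p by (simp add: field_simps)
qed

section \<open>Gradient descent\<close>

definition step_size :: "'a \<Rightarrow> real" where
  "step_size x = integral {0..1} (\<lambda>v. 1 / l (norm (G x) + norm (G x) * v))"

lemma step_size_bounds:
  shows "1 / l (2 * norm (G x)) \<le> step_size x" and "step_size x \<le> 1 / l (norm (G x))"
proof -
  define g where "g = norm (G x)"
  have g: "0 \<le> g" by (simp add: g_def)
  have "continuous_on {0..1} (\<lambda>v. 1 / l (g + g * v))"
  proof (rule continuous_on_compose2[OF continuous_inverse_l[OF g, of g]])
    show "(\<lambda>v. g * v) ` {0..1} \<subseteq> {0..g}"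
      using g by (auto intro: mult_left_le)
  qed (intro continuous_intros)
  then have int: "(\<lambda>v. 1 / l (g + g * v)) integrable_on {0..1}"
    by (rule integrable_continuous_interval)
  have pos: "0 < l (g + g * v)" if "0 \<le> v" for v using g that by (intro l_pos) simp
  have upper: "l (g + g * v) \<le> l (2 * g)" if "0 \<le> v" "v \<le> 1" for v
    using g that mult_left_mono[of v 1 g] by (intro l_mono) auto
  have lower: "l g \<le> l (g + g * v)" if "0 \<le> v" for v
    using g that by (intro l_mono) auto
  have "integral {0..1} (\<lambda>v::real. 1 / l (2 * g)) \<le> step_size x"
    unfolding step_size_def g_def[symmetric]
    using pos upper l_pos[of "2 * g"] g
    by (intro integral_le int integrable_const_ivl) (auto intro!: divide_left_mono)
  then show "1 / l (2 * norm (G x)) \<le> step_size x" by (simp add: g_def)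
  have "step_size x \<le> integral {0..1} (\<lambda>v::real. 1 / l g)"
    unfolding step_size_def g_def[symmetric]
    using pos lower l_pos[of g] g
    by (intro integral_le int integrable_const_ivl) (auto intro!: divide_left_mono)
  then show "step_size x \<le> 1 / l (norm (G x))" by (simp add: g_def)
qed

lemma step_size_pos: "0 < step_size x"
  using step_size_bounds(1)[of x] l_pos[of "2 * norm (G x)"]
  by (smt (verit) norm_ge_zero zero_less_divide_1_iff)

lemma step_size_eq_min_length:
  "step_size x * norm (G x) = min_length (norm (G x)) (norm (G x))"
proof (cases "G x = 0")
  case False
  define g where "g = norm (G x)"
  have g: "0 < g" using False by (simp add: g_def)
  have "((\<lambda>u. 1 / l (g + u)) has_integral min_length g g) (cbox 0 g)"
    using integrable_continuous_interval[OF continuous_inverse_l[of g g]] g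
    by (simp add: min_length_def integrable_integral)
  from has_integral_affinity[OF this, of g 0]
  have "((\<lambda>v. 1 / l (g + g * v)) has_integral min_length g g / g) ((\<lambda>v. v / g) ` {0..g})"
    using g by simp
  moreover have "(\<lambda>v. v / g) ` {0..g} = {0..1}"
    using g by (simp add: image_divide_atLeastAtMost)
  ultimately have "step_size x = min_length g g / g"
    unfolding step_size_def g_def[symmetric] by (simp add: integral_unique)
  then show ?thesis using g by (simp add: g_def)
qed simp

lemma descent_step:
  assumes x: "x \<in> X"
  defines "x' \<equiv> x - step_size x *\<^sub>R G x"
  shows "x' \<in> X"
    and "(norm (x' - xs))\<^sup>2 \<le> (norm (x - xs))\<^sup>2 - 2 * step_size x * (F x - F xs)"
proof -
  define g where "g = norm (G x)"
  define \<gamma> where "\<gamma> = step_size x"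
  have \<gamma>: "0 < \<gamma>" "\<gamma> \<le> 1 / l g"
    using step_size_pos step_size_bounds(2) by (auto simp: \<gamma>_def g_def)
  have "norm (- (\<gamma> *\<^sub>R G x)) \<le> min_length (norm (G x)) (norm (G x))"
    using \<gamma> step_size_eq_min_length[of x] by (simp add: \<gamma>_def)
  from step_in_domain(1)[OF x norm_ge_zero this, of 1] show "x' \<in> X"
    by (simp add: x'_def \<gamma>_def)
  have "x' - xs = (x - xs) - \<gamma> *\<^sub>R G x"
    by (simp add: x'_def \<gamma>_def)
  then have "(norm (x' - xs))\<^sup>2 = (norm (x - xs))\<^sup>2 - 2 * \<gamma> * (G x \<bullet> (x - xs)) + \<gamma> * (\<gamma> * g\<^sup>2)"
    unfolding g_def power2_norm_eq_inner
    by (simp only: inner_diff_left[of "x - xs"] inner_diff_right[of _ "x - xs"] inner_scaleR_left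
        inner_scaleR_right inner_commute[of "x - xs" "G x"])
      (simp add: algebra_simps)
  moreover have "\<gamma> * (\<gamma> * g\<^sup>2) \<le> \<gamma> * (g\<^sup>2 / l g)"
    using \<gamma> mult_right_mono[OF \<gamma>(2), of "g\<^sup>2"] by (intro mult_left_mono) auto
  moreover have "2 * \<gamma> * (F x - F xs + g\<^sup>2 / (2 * l g)) \<le> 2 * \<gamma> * (G x \<bullet> (x - xs))"
    using \<gamma> inner_lower_bound[OF x] unfolding g_def by (intro mult_left_mono) auto
  ultimately show "(norm (x' - xs))\<^sup>2 \<le> (norm (x - xs))\<^sup>2 - 2 * step_size x * (F x - F xs)"
    by (simp add: \<gamma>_def[symmetric] algebra_simps)
qed

lemma descent_sequence:
  assumes "x 0 \<in> X" and step: "\<And>k. x (Suc k) = x k - step_size (x k) *\<^sub>R G (x k)"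
  shows "x n \<in> X"
    and "(norm (x n - xs))\<^sup>2 + 2 * (\<Sum>k<n. step_size (x k) * (F (x k) - F xs))
      \<le> (norm (x 0 - xs))\<^sup>2"
proof -
  have inX: "x n \<in> X" for n
    by (induction n) (use assms descent_step(1) in auto)
  then show "x n \<in> X" .
  show "(norm (x n - xs))\<^sup>2 + 2 * (\<Sum>k<n. step_size (x k) * (F (x k) - F xs))
      \<le> (norm (x 0 - xs))\<^sup>2"
  proof (induction n)
    case (Suc n)
    then show ?case
      using descent_step(2)[OF inX[of n]] by (simp add: step[of n] algebra_simps)
  qed simp
qed

text \<open>The factor \<open>2\<close> in the hypothesis is what the averaging argument provides. It is spent in the
  case of a small gradient, in which monotonicity of \<open>s\<^sup>2 / l (2 s)\<close> only yields
  \<open>l (2 g) \<le> (g / s)\<^sup>2 l (2 s)\<close>. The threshold \<open>sqrt 2 s\<close> is the gradient norm up to which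
  this is at most \<open>2 l (2 s)\<close>. From that norm on, the gap bound \<open>p\<^sup>2 / (2 l p)\<close> at \<open>p = sqrt 2 s\<close>
  makes up for its own factor \<open>2\<close>.\<close>

lemma step_size_to_gap:
  assumes x: "x \<in> X" and s: "0 < s"
    and mono: "strict_mono_on {0..} (\<lambda>s. s\<^sup>2 / l (2 * s))"
    and small: "2 * s\<^sup>2 * step_size x \<le> F x - F xs"
  shows "s\<^sup>2 \<le> (F x - F xs) * l (2 * s)"
proof -
  define g where "g = norm (G x)"
  have l_2s: "0 < l (2 * s)" using s by (intro l_pos) simp
  show ?thesis
  proof (cases "sqrt 2 * s \<le> g")
    case True
    have le: "sqrt 2 * s \<le> 2 * s"
      using s sqrt2_less_2 by (intro mult_right_mono) auto
    have l_p: "0 < l (sqrt 2 * s)" using s by (intro l_pos) simp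
    have "s\<^sup>2 / l (2 * s) \<le> s\<^sup>2 / l (sqrt 2 * s)"
      using s l_p l_2s l_mono[OF _ le] by (intro divide_left_mono) auto
    also have "\<dots> = (sqrt 2 * s)\<^sup>2 / (2 * l (sqrt 2 * s))"
      by (simp add: power_mult_distrib)
    also have "\<dots> \<le> F x - F xs"
      using gap_lower_bound[OF x _ True[unfolded g_def]] s by simp
    finally show ?thesis using l_2s by (simp add: field_simps)
  next
    case False
    have g: "0 \<le> g" by (simp add: g_def)
    have l_2g: "0 < l (2 * g)" using g by (intro l_pos) simp
    have "l (2 * g) \<le> 2 * l (2 * s)"
    proof (cases "g \<le> s")
      case True
      then have "l (2 * g) \<le> l (2 * s)" using g by (intro l_mono) auto
      with l_2s show ?thesis by linarith
    next
      case False
      then have "s\<^sup>2 / l (2 * s) < g\<^sup>2 / l (2 * g)"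
        using s g by (intro strict_mono_onD[OF mono]) auto
      then have "s\<^sup>2 * l (2 * g) \<le> g\<^sup>2 * l (2 * s)"
        using l_2s l_2g by (simp add: field_simps)
      also have "\<dots> \<le> (2 * s\<^sup>2) * l (2 * s)"
      proof (rule mult_right_mono)
        have "g\<^sup>2 \<le> (sqrt 2 * s)\<^sup>2"
          using g \<open>\<not> sqrt 2 * s \<le> g\<close> by (intro power_mono) auto
        then show "g\<^sup>2 \<le> 2 * s\<^sup>2" by (simp add: power_mult_distrib)
      qed (use l_2s in simp)
      finally have "s\<^sup>2 * l (2 * g) \<le> s\<^sup>2 * (2 * l (2 * s))" by (simp only: mult_ac)
      then show ?thesis using s by simp
    qed
    then have "1 / (2 * l (2 * s)) \<le> 1 / l (2 * g)"
      using l_2s l_2g by (intro divide_left_mono) auto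
    also have "\<dots> \<le> step_size x"
      unfolding g_def by (rule step_size_bounds(1))
    finally have "2 * s\<^sup>2 * (1 / (2 * l (2 * s))) \<le> 2 * s\<^sup>2 * step_size x"
      by (intro mult_left_mono) auto
    also note small
    finally show ?thesis using l_2s by (simp add: field_simps)
  qed
qed

text \<open>The averaging argument selects \<open>k\<close>. If \<open>x 0 = xs\<close>, it forces the gap at \<open>k\<close> to be \<open>0\<close>, so the
  quotient vanishes although the argument of \<open>l\<close> then involves a division by zero.\<close>

lemma min_gap_bound:
  assumes x0: "x 0 \<in> X" and step: "\<And>k. x (Suc k) = x k - step_size (x k) *\<^sub>R G (x k)"
    and mono: "strict_mono_on {0..} (\<lambda>s. s\<^sup>2 / l (2 * s))"
  shows "\<exists>k\<le>T. (F (x k) - F xs) / l (2 * sqrt (real T + 1) * (F (x k) - F xs) / norm (x 0 - xs))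
    \<le> (norm (x 0 - xs))\<^sup>2 / (real T + 1)"
proof -
  define R where "R = norm (x 0 - xs)"
  define D where "D k = F (x k) - F xs" for k
  have inX: "x k \<in> X" for k by (rule descent_sequence(1)[of x, OF x0 step])
  have "\<exists>k\<le>T. step_size (x k) * D k \<le> R\<^sup>2 / (2 * (real T + 1))"
  proof (rule ccontr)
    assume "\<not> ?thesis"
    then have "R\<^sup>2 / (2 * (real T + 1)) < step_size (x k) * D k" if "k \<le> T" for k
      using that by (meson not_le)
    then have "(\<Sum>k<Suc T. R\<^sup>2 / (2 * (real T + 1))) < (\<Sum>k<Suc T. step_size (x k) * D k)"
      by (intro sum_strict_mono) (auto simp: less_Suc_eq_le lessThan_empty_iff)
    moreover have "2 * (\<Sum>k<Suc T. step_size (x k) * D k) \<le> R\<^sup>2"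
      using descent_sequence(2)[of x "Suc T", OF x0 step] zero_le_power2[of "norm (x (Suc T) - xs)"]
      unfolding R_def D_def by linarith
    moreover have "(\<Sum>k<Suc T. R\<^sup>2 / (2 * (real T + 1))) = R\<^sup>2 / 2"
      by (simp add: field_simps)
    ultimately show False by linarith
  qed
  then obtain k where k: "k \<le> T" "step_size (x k) * D k \<le> R\<^sup>2 / (2 * (real T + 1))"
    by blast
  define s where "s = sqrt (real T + 1) * D k / R"
  have D: "0 \<le> D k" using minimizer(2)[OF inX] by (simp add: D_def)
  have "D k / l (2 * s) \<le> R\<^sup>2 / (real T + 1)"
  proof (cases "R = 0 \<or> D k = 0")
    case True
    then have "D k = 0"
    proof
      assume "R = 0"
      then have "step_size (x k) * D k \<le> 0" using k(2) by simp
      then show "D k = 0" using D step_size_pos[of "x k"] by (simp add: mult_le_0_iff)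
    qed
    then show ?thesis by simp
  next
    case False
    then have pos: "0 < R" "0 < D k" using D by (auto simp: R_def)
    then have s: "0 < s" by (simp add: s_def)
    have s2: "s\<^sup>2 = (real T + 1) * (D k)\<^sup>2 / R\<^sup>2"
      by (simp add: s_def power_divide power_mult_distrib)
    have "2 * s\<^sup>2 * step_size (x k) = (2 * (real T + 1) * D k / R\<^sup>2) * (step_size (x k) * D k)"
      unfolding s2 by (simp add: power2_eq_square)
    also have "\<dots> \<le> (2 * (real T + 1) * D k / R\<^sup>2) * (R\<^sup>2 / (2 * (real T + 1)))"
      using pos by (intro mult_left_mono k(2)) auto
    also have "\<dots> = D k"
    proof -
      have cancel: "P * D k / R\<^sup>2 * (R\<^sup>2 / P) = D k" if "0 < P" for P
        using pos that by simp
      show ?thesis by (rule cancel) (simp add: add_nonneg_pos)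
    qed
    finally have "s\<^sup>2 \<le> D k * l (2 * s)"
      using step_size_to_gap[OF inX s mono] by (simp add: D_def)
    then have "(real T + 1) * D k / R\<^sup>2 * D k \<le> l (2 * s) * D k"
      unfolding s2 by (simp add: power2_eq_square mult_ac)
    then have "(real T + 1) * D k / R\<^sup>2 \<le> l (2 * s)"
      using pos(2) by (rule mult_right_le_imp_le)
    moreover have "0 < l (2 * s)" using s by (intro l_pos) simp
    ultimately show ?thesis
      using pos by (simp add: field_simps)
  qed
  moreover have "2 * s = 2 * sqrt (real T + 1) * D k / R" by (simp add: s_def)
  ultimately show ?thesis using k(1) by (auto simp: D_def R_def)
qed

end

section \<open>Extended-valued functions\<close>

lemma gradient_eqI:
  fixes f :: "real ^ 'n \<Rightarrow> ereal"
  assumes "GDERIV (\<lambda>y. real_of_ereal (f y)) x :> g"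
  shows "gradient f x = g"
  unfolding gradient_def
proof (rule the_equality)
  show "GDERIV (\<lambda>y. real_of_ereal (f y)) x :> g" by (fact assms)
next
  fix g' assume "GDERIV (\<lambda>y. real_of_ereal (f y)) x :> g'"
  then have "(\<lambda>h. h \<bullet> g') = (\<lambda>h. h \<bullet> g)"
    using assms unfolding gderiv_def by (rule has_derivative_unique)
  then have "(g' - g) \<bullet> (g' - g) = 0"
    by (metis inner_diff_right right_minus_eq)
  then show "g' = g" by simp
qed

lemma gradient_has_derivative:
  fixes f :: "real ^ 'n \<Rightarrow> ereal"
  assumes "(\<lambda>y. real_of_ereal (f y)) differentiable (at x)"
  shows "((\<lambda>y. real_of_ereal (f y)) has_derivative (\<lambda>h. gradient f x \<bullet> h)) (at x)"
proof -
  obtain D where D: "((\<lambda>y. real_of_ereal (f y)) has_derivative D) (at x)"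
    using assms by (auto simp: differentiable_def)
  define g where "g = (\<Sum>i\<in>Basis. D i *\<^sub>R i)"
  have "D h = g \<bullet> h" for h
  proof -
    have "D h = D (\<Sum>i\<in>Basis. (h \<bullet> i) *\<^sub>R i)" by (simp add: euclidean_representation)
    also have "\<dots> = (\<Sum>i\<in>Basis. (h \<bullet> i) * D i)"
      using has_derivative_linear[OF D] by (simp add: linear_sum linear_cmul)
    finally show ?thesis
      by (simp add: g_def inner_sum_left inner_sum_right inner_commute[of _ h] mult.commute)
  qed
  then have *: "((\<lambda>y. real_of_ereal (f y)) has_derivative (\<lambda>h. g \<bullet> h)) (at x)"
    using D by (metis ext)
  then have "gradient f x = g"
    by (intro gradient_eqI) (simp add: gderiv_def inner_commute)
  with * show ?thesis by simp
qed

lemma hessian_has_derivative: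
  assumes "gradient f differentiable (at x)"
  shows "(gradient f has_derivative (\<lambda>h. hessian f x *v h)) (at x)"
  using assms by (simp add: jacobian_works hessian_def)

lemma norm_matrix_vector_le: "norm (A *v h) \<le> spectral_norm A * norm h"
  unfolding spectral_norm_def by (rule onorm[OF matrix_vector_mul_bounded_linear])

lemma closed_sublevel_of_continuous_on_closure:
  fixes f :: "'a::topological_space \<Rightarrow> ereal"
  assumes not_minus: "\<And>z. f z \<noteq> -\<infinity>" and cont: "continuous_on (closure (effective_domain f)) f"
  shows "closed {y \<in> effective_domain f. real_of_ereal (f y) \<le> B}"
proof -
  have "{y \<in> effective_domain f. real_of_ereal (f y) \<le> B} =
    closure (effective_domain f) \<inter> f -` {..ereal B}"
  proof (intro set_eqI iffI; clarsimp)
    fix y assume "y \<in> effective_domain f" "real_of_ereal (f y) \<le> B"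
    then show "y \<in> closure (effective_domain f) \<and> f y \<le> ereal B"
      using not_minus[of y] subsetD[OF closure_subset, of y] by (cases "f y") (auto simp: effective_domain_def)
  next
    fix y assume "f y \<le> ereal B"
    then show "y \<in> effective_domain f \<and> real_of_ereal (f y) \<le> B"
      using not_minus[of y] by (cases "f y") (auto simp: effective_domain_def)
  qed
  then show ?thesis using cont by (simp add: continuous_closed_preimage)
qed

lemma convex_on_of_convex_extended:
  assumes not_minus: "\<And>z. f z \<noteq> -\<infinity>" and dom: "convex (effective_domain f)"
    and conv: "convex_extended f"
  shows "convex_on (effective_domain f) (\<lambda>y. real_of_ereal (f y))"
proof (rule convex_onI[OF _ dom])
  fix t :: real and y z
  assume t: "0 < t" "t < 1" and yz: "y \<in> effective_domain f" "z \<in> effective_domain f"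
  have fin: "f w = ereal (real_of_ereal (f w))" if "w \<in> effective_domain f" for w
    using that not_minus[of w] by (cases "f w") (auto simp: effective_domain_def)
  define w where "w = (1 - t) *\<^sub>R y + t *\<^sub>R z"
  have w: "w \<in> effective_domain f"
    unfolding w_def using convexD_alt[OF dom yz, of t] t by simp
  have "f w \<le> ereal (1 - t) * f y + ereal t * f z"
    using conv t unfolding convex_extended_def w_def by simp
  then have "ereal (real_of_ereal (f w)) \<le>
      ereal ((1 - t) * real_of_ereal (f y) + t * real_of_ereal (f z))"
    using fin[OF w] fin[OF yz(1)] fin[OF yz(2)] by (metis plus_ereal.simps(1) times_ereal.simps(1))
  then show "real_of_ereal (f ((1 - t) *\<^sub>R y + t *\<^sub>R z)) \<le>
      (1 - t) * real_of_ereal (f y) + t * real_of_ereal (f z)"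
    by (simp add: w_def)
qed

lemma ell_smooth_imp_generalized_smooth:
  assumes not_minus: "\<And>z. f z \<noteq> -\<infinity>" and dom: "open (effective_domain f)"
    "convex (effective_domain f)" and smooth: "ell_smooth l f"
  shows "generalized_smooth (effective_domain f) (\<lambda>y. real_of_ereal (f y)) (gradient f)
    (\<lambda>y h. hessian f y *v h) l"
proof
  have twice: "twice_differentiable_on (effective_domain f) f"
    and cont: "continuous_on (closure (effective_domain f)) f"
    and pos: "\<And>s. 0 \<le> s \<Longrightarrow> 0 < l s" and mono: "mono_on {0..} l"
    and lip: "local_lipschitz (UNIV :: real set) {0..} (\<lambda>_. l)"
    and bound: "\<And>x. x \<in> effective_domain f \<Longrightarrow>
      spectral_norm (hessian f x) \<le> l (norm (gradient f x))"
    using smooth unfolding ell_smooth_def by blast+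
  show "open (effective_domain f)" "convex (effective_domain f)" by (fact dom)+
  show "closed {y \<in> effective_domain f. real_of_ereal (f y) \<le> B}" for B
    by (rule closed_sublevel_of_continuous_on_closure[OF not_minus cont])
  show "((\<lambda>y. real_of_ereal (f y)) has_derivative (\<bullet>) (gradient f y)) (at y)"
    if "y \<in> effective_domain f" for y
    using twice that gradient_has_derivative unfolding twice_differentiable_on_def by blast
  show "(gradient f has_derivative (*v) (hessian f y)) (at y)" if "y \<in> effective_domain f" for y
    using twice that hessian_has_derivative unfolding twice_differentiable_on_def by blast
  show "norm (hessian f y *v h) \<le> l (norm (gradient f y)) * norm h"
    if "y \<in> effective_domain f" for y h
    using norm_matrix_vector_le[of "hessian f y" h] mult_right_mono[OF bound[OF that], of "norm h"]
    by simp
  show "0 < l s" if "0 \<le> s" for s using pos that .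
  show "l s \<le> l t" if "0 \<le> s" "s \<le> t" for s t
    using that by (intro mono_onD[OF mono]) auto
  show "continuous_on {0..} l"
    by (rule local_lipschitz_continuous_on[OF lip]) simp
qed

theorem theorem7p2:
  fixes f :: "real ^ 'n \<Rightarrow> ereal"
    and l :: "real \<Rightarrow> real"
    and xs :: "real ^ 'n"
    and x :: "nat \<Rightarrow> real ^ 'n"
    and \<gamma> :: "nat \<Rightarrow> real"
    and T :: nat
  assumes "\<And>z. f z \<noteq> -\<infinity>"
    and "open (effective_domain f)"
    and "convex (effective_domain f)"
    and "ell_smooth l f"
    and "convex_extended f"
    and "\<And>z. f xs \<le> f z"
    and "strict_mono_on {0..} (\<lambda>s. s\<^sup>2 / l (2 * s))"
    and "filterlim (\<lambda>s. s\<^sup>2 / l (2 * s)) at_top at_top"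
    and "x 0 \<in> effective_domain f"
    and "\<And>k. x (Suc k) = x k - \<gamma> k *\<^sub>R gradient f (x k)"
    and "\<And>k. \<gamma> k =
           integral {0..1} (\<lambda>v. 1 / l (norm (gradient f (x k)) + norm (gradient f (x k)) * v))"
  shows "(MIN k\<in>{0..T}.
            real_of_ereal (f (x k) - f xs) /
              l (2 * sqrt (real T + 1) * real_of_ereal (f (x k) - f xs) / norm (x 0 - xs)))
         \<le> (norm (x 0 - xs))\<^sup>2 / (real T + 1)"
proof -
  have xs: "xs \<in> effective_domain f"
    using assms(6)[of "x 0"] assms(9) unfolding effective_domain_def mem_Collect_eq
    by (rule le_less_trans)
  have fin: "f z = ereal (real_of_ereal (f z))" if "z \<in> effective_domain f" for z
    using that assms(1)[of z] by (cases "f z") (auto simp: effective_domain_def)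
  interpret generalized_smooth "effective_domain f" "\<lambda>y. real_of_ereal (f y)" "gradient f"
    "\<lambda>y h. hessian f y *v h" l
    using assms(1-4) by (rule ell_smooth_imp_generalized_smooth)
  interpret convex_generalized_smooth "effective_domain f" "\<lambda>y. real_of_ereal (f y)" "gradient f"
    "\<lambda>y h. hessian f y *v h" l xs
  proof
    show "convex_on (effective_domain f) (\<lambda>y. real_of_ereal (f y))"
      using assms(1,3,5) by (rule convex_on_of_convex_extended)
    show "real_of_ereal (f xs) \<le> real_of_ereal (f y)" if "y \<in> effective_domain f" for y
      using assms(6)[of y] fin[OF xs] fin[OF that] by (metis ereal_less_eq(3))
  qed (fact xs)
  have step: "x (Suc k) = x k - step_size (x k) *\<^sub>R gradient f (x k)" for k
    using assms(10,11) by (simp add: step_size_def)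
  have diff: "real_of_ereal (f (x k) - f xs) = real_of_ereal (f (x k)) - real_of_ereal (f xs)" for k
  proof -
    have "x k \<in> effective_domain f"
      by (rule descent_sequence(1)[of x, OF assms(9) step])
    from fin[OF this] fin[OF xs] show ?thesis by (metis ereal_minus(1) real_of_ereal.simps(1))
  qed
  obtain k where "k \<le> T"
    "real_of_ereal (f (x k) - f xs) /
        l (2 * sqrt (real T + 1) * real_of_ereal (f (x k) - f xs) / norm (x 0 - xs))
      \<le> (norm (x 0 - xs))\<^sup>2 / (real T + 1)"
    using min_gap_bound[of x, OF assms(9) step assms(7)] unfolding diff by blast
  then show ?thesis by (subst Min_le_iff) auto
qed

end
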